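(* Let $(\Omega,\mathcal{F},(\mathcal{F}_i)_{i\ge -1},P)$ be a filtered probability space. Let $(X_{i+1})_{i\ge 0}$, $(Y_i)_{i\ge 0}$, and $(Z_i)_{i\ge 0}$ be real random sequences adapted to $(\mathcal{F}_i)_{i\ge0}$ (i.e. $X_{i+1},Y_i,Z_i$ are $\mathcal{F}_i$-measurable), and let $X_0$ be deterministic. Let $(\alpha_i)_{i\ge0}$ and $(\beta_i)_{i\ge0}$ be sequences of non-negative reals and let $(\gamma_i)_{i\ge0}$ be a sequence of positive reals. Assume $X_i$ and $Z_i$ are non-negative almost surely. Assume that for all $i\ge0$, $\mathbb{E}[\exp(\lambda Y_i)\mid\mathcal{F}_{i-1}]\le\exp\left(\frac{\lambda^2}{2}\beta_i^2X_i\right)$ for all $\lambda\in\mathbb{R}$ and $\mathbb{E}[\exp(\lambda Z_i)\mid\mathcal{F}_{i-1}]\le\exp(\lambda\gamma_i)$ for all $\lambda\in[0,\gamma_i^{-1}]$. Assume $$X_{i+1}\le\alpha_iX_i+Y_i+Z_i\quad\text{for all } i\ge0.$$ Then, for any sequence of positive reals $(K_i)_{i\ge0}$ such that $K_0\ge X_0$ and, for all $i\ge0$, $K_{i+1}^2\ge(\alpha_iK_i+2\gamma_i)K_{i+1}+\beta_i^2K_i$, and for any $n\ge0$ and any $\delta\in(0,1)$, with probability at least $1-\delta$, $$X_n\le K_n\log(e/\delta).$$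
   Context: A filtration is a nested increasing sequence of sub-sigma-algebras of $\mathcal{F}$. In $\log(e/\delta)$, $e$ is Euler's number. Conditional inequalities are understood almost surely. *)

theory Defs
  imports "HOL-Probability.Probability"
begin

text \<open>
  The integer index follows the usual convention that a filtration starts at time \<open>-1\<close>; the
  values of \<open>F\<close> below \<open>-1\<close> are irrelevant.
\<close>

definition filtered_prob_space :: "'a measure \<Rightarrow> (int \<Rightarrow> 'a measure) \<Rightarrow> bool" where
  "filtered_prob_space M F \<longleftrightarrow>
     prob_space M \<and>
     (\<forall>i\<ge>-1. subalgebra M (F i)) \<and>
     (\<forall>i\<ge>-1. \<forall>j\<ge>i. sets (F i) \<subseteq> sets (F j))"

text \<open>
  Conditional expectations of the non-negative variables \<open>exp (\<lambda> Y)\<close> are taken with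
  \<^const>\<open>nn_cond_exp\<close>, which is meaningful without an integrability assumption (the real-valued
  \<^const>\<open>real_cond_exp\<close> would not be: it turns an infinite conditional expectation into \<open>0\<close>).
\<close>

end

theory Submission
  imports Defs
begin

text \<open>
  The proof bounds exponential moments: writing \<open>E\<close> for expectation, the claim
  \<open>E (exp (l X\<^sub>n)) \<le> exp (l K\<^sub>n)\<close> for all \<open>0 \<le> l \<le> 1 / K\<^sub>n\<close> is shown by induction on \<open>n\<close>
  (\<open>mgf_bound_along_recursion\<close>). At the largest admissible \<open>l = 1 / K\<^sub>n\<close> the moment is at most
  \<open>e\<close>, and Markov's inequality turns this into the stated tail bound: exceeding
  \<open>K\<^sub>n log (e / \<delta>)\<close> means \<open>exp (X\<^sub>n / K\<^sub>n) > e / \<delta>\<close>, which has probability at most \<open>\<delta>\<close>.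

  In the inductive step, conditioning on the past replaces \<open>Y\<close> and \<open>Z\<close> by their moment bounds
  and leaves an exponential moment of \<open>X\<^sub>n\<close>, at the new parameter
  \<open>l \<alpha> + l\<^sup>2 \<beta>\<^sup>2\<close> (\<open>mgf_one_step\<close>). The noise \<open>Y\<close> thus costs a term proportional to \<open>X\<^sub>n\<close> itself, and
  the induction closes because the quadratic condition on \<open>K\<close> says both that this parameter is
  again admissible, i.e. at most \<open>1 / K\<^sub>n\<close>, and that the accumulated
  exponent is at most \<open>l K\<^sub>n\<^sub>+\<^sub>1\<close> (\<open>recursion_parameter_bounds\<close>).
\<close>

text \<open>
  Since \<open>U\<close> is known given \<open>G\<close>, the tower property lets \<open>V\<close> be replaced by its conditional
  expectation under the integral.
\<close>

lemma nn_integral_mult_le_of_nn_cond_exp_le: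
  assumes "sigma_finite_subalgebra M G"
    and "U \<in> borel_measurable G" and "V \<in> borel_measurable M"
    and "AE \<omega> in M. nn_cond_exp M G V \<omega> \<le> W \<omega>"
  shows "(\<integral>\<^sup>+ \<omega>. U \<omega> * V \<omega> \<partial>M) \<le> (\<integral>\<^sup>+ \<omega>. U \<omega> * W \<omega> \<partial>M)"
proof -
  have "(\<integral>\<^sup>+ \<omega>. U \<omega> * V \<omega> \<partial>M) = (\<integral>\<^sup>+ \<omega>. U \<omega> * nn_cond_exp M G V \<omega> \<partial>M)"
    using sigma_finite_subalgebra.nn_cond_exp_intg[OF assms(1-3)] by simp
  also have "\<dots> \<le> (\<integral>\<^sup>+ \<omega>. U \<omega> * W \<omega> \<partial>M)"
    using assms(4) by (intro nn_integral_mono_AE, elim AE_mp) (auto intro!: AE_I2 mult_left_mono)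
  finally show ?thesis .
qed

text \<open>
  \<open>Y\<close> and \<open>Z\<close> need not be independent given \<open>G\<close>, so they are separated by the conditional
  Cauchy-Schwarz inequality; this is why their moment bounds are used at \<open>2 l\<close>. Rather than taking
  square roots of conditional expectations, the proof uses the inequality between arithmetic and
  geometric mean, with a \<open>G\<close>-measurable weight that makes the bounds on both summands equal.
\<close>

lemma mgf_one_step:
  fixes X Y Z :: "'a \<Rightarrow> real" and a b c l :: real
  assumes G: "sigma_finite_subalgebra M G"
    and X: "X \<in> borel_measurable G"
    and Y: "Y \<in> borel_measurable M" and Z: "Z \<in> borel_measurable M"
    and Y_mgf: "AE \<omega> in M. nn_cond_exp M G (\<lambda>\<omega>. ennreal (exp ((2 * l) * Y \<omega>))) \<omega>
        \<le> ennreal (exp ((2 * l)\<^sup>2 / 2 * b\<^sup>2 * X \<omega>))"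
    and Z_mgf: "AE \<omega> in M. nn_cond_exp M G (\<lambda>\<omega>. ennreal (exp ((2 * l) * Z \<omega>))) \<omega>
        \<le> ennreal (exp ((2 * l) * c))"
  shows "(\<integral>\<^sup>+ \<omega>. ennreal (exp (l * (a * X \<omega> + Y \<omega> + Z \<omega>))) \<partial>M)
    \<le> ennreal (exp (l * c)) * (\<integral>\<^sup>+ \<omega>. ennreal (exp ((l * a + l\<^sup>2 * b\<^sup>2) * X \<omega>)) \<partial>M)"
proof -
  have XM: "X \<in> borel_measurable M"
    using X sigma_finite_subalgebra.subalg[OF G] measurable_from_subalg by blast
  note [measurable] = X XM Y Z
  \<comment> \<open>\<open>p\<close> and \<open>q\<close> are the weights of the mean inequality; multiplied by the moment bounds on
      \<open>exp (2 l Y)\<close> and \<open>exp (2 l Z)\<close>, both become \<open>r / 2\<close>.\<close>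
  define p where "p x = exp (l * a * x - l\<^sup>2 * b\<^sup>2 * x + l * c) / 2" for x
  define q where "q x = exp (l * a * x + l\<^sup>2 * b\<^sup>2 * x - l * c) / 2" for x
  define r where "r x = exp ((l * a + l\<^sup>2 * b\<^sup>2) * x + l * c)" for x
  have [measurable]: "p \<in> borel_measurable borel" "q \<in> borel_measurable borel"
      "r \<in> borel_measurable borel"
    unfolding p_def q_def r_def by measurable
  have pos: "0 \<le> p x" "0 \<le> q x" "0 \<le> r x" for x
    by (simp_all add: p_def q_def r_def)
  have amgm: "exp (l * (a * x + y + z)) \<le> p x * exp (2 * l * y) + q x * exp (2 * l * z)" for x y z
  proof -
    define s where "s = exp ((l * a * x - l\<^sup>2 * b\<^sup>2 * x + l * c + 2 * l * y) / 2)"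
    define t where "t = exp ((l * a * x + l\<^sup>2 * b\<^sup>2 * x - l * c + 2 * l * z) / 2)"
    have st: "s * t = exp (l * (a * x + y + z))"
      unfolding s_def t_def exp_add[symmetric] by (simp add: field_simps)
    have ss: "s\<^sup>2 = 2 * (p x * exp (2 * l * y))" and tt: "t\<^sup>2 = 2 * (q x * exp (2 * l * z))"
      unfolding s_def t_def p_def q_def exp_double[symmetric] by (simp_all add: exp_add[symmetric])
    show ?thesis
      using sum_squares_bound[of s t] unfolding st[symmetric] using ss tt by linarith
  qed
  have pr: "p x * exp ((2 * l)\<^sup>2 / 2 * b\<^sup>2 * x) = r x / 2" for x
    unfolding p_def r_def
    by (simp add: exp_add[symmetric]) (simp add: algebra_simps power2_eq_square)
  have qr: "q x * exp ((2 * l) * c) = r x / 2" for x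
    unfolding q_def r_def
    by (simp add: exp_add[symmetric]) (simp add: algebra_simps power2_eq_square)
  have "(\<integral>\<^sup>+ \<omega>. ennreal (exp (l * (a * X \<omega> + Y \<omega> + Z \<omega>))) \<partial>M)
      \<le> (\<integral>\<^sup>+ \<omega>. ennreal (p (X \<omega>)) * ennreal (exp ((2 * l) * Y \<omega>))
             + ennreal (q (X \<omega>)) * ennreal (exp ((2 * l) * Z \<omega>)) \<partial>M)"
    using amgm pos
    by (intro nn_integral_mono) (simp add: ennreal_mult[symmetric] ennreal_plus[symmetric]
        del: ennreal_plus)
  also have "\<dots> = (\<integral>\<^sup>+ \<omega>. ennreal (p (X \<omega>)) * ennreal (exp ((2 * l) * Y \<omega>)) \<partial>M)
             + (\<integral>\<^sup>+ \<omega>. ennreal (q (X \<omega>)) * ennreal (exp ((2 * l) * Z \<omega>)) \<partial>M)"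
    by (intro nn_integral_add) measurable
  also have "\<dots> \<le> (\<integral>\<^sup>+ \<omega>. ennreal (p (X \<omega>)) * ennreal (exp ((2 * l)\<^sup>2 / 2 * b\<^sup>2 * X \<omega>)) \<partial>M)
             + (\<integral>\<^sup>+ \<omega>. ennreal (q (X \<omega>)) * ennreal (exp ((2 * l) * c)) \<partial>M)"
    using G Y_mgf Z_mgf by (intro add_mono nn_integral_mult_le_of_nn_cond_exp_le) measurable
  also have "\<dots> = (\<integral>\<^sup>+ \<omega>. ennreal (r (X \<omega>) / 2) \<partial>M) + (\<integral>\<^sup>+ \<omega>. ennreal (r (X \<omega>) / 2) \<partial>M)"
    unfolding pr[symmetric] using pos qr[unfolded pr[symmetric]]
    by (simp add: ennreal_mult[symmetric])
  also have "\<dots> = (\<integral>\<^sup>+ \<omega>. ennreal (r (X \<omega>) / 2) + ennreal (r (X \<omega>) / 2) \<partial>M)"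
    by (intro nn_integral_add[symmetric]) measurable
  also have "\<dots> = (\<integral>\<^sup>+ \<omega>. ennreal (exp (l * c)) * ennreal (exp ((l * a + l\<^sup>2 * b\<^sup>2) * X \<omega>)) \<partial>M)"
    using pos by (simp add: ennreal_mult[symmetric] ennreal_plus[symmetric] r_def
        exp_add[symmetric] add.commute del: ennreal_plus)
  also have "\<dots> = ennreal (exp (l * c)) * (\<integral>\<^sup>+ \<omega>. ennreal (exp ((l * a + l\<^sup>2 * b\<^sup>2) * X \<omega>)) \<partial>M)"
    by (intro nn_integral_cmult) measurable
  finally show ?thesis .
qed

text \<open>
  Dividing the quadratic condition by \<open>k'\<close> gives \<open>a k + b\<^sup>2 k / k' + 2 c \<le> k'\<close>. Dropping the first two
  terms yields the first bound, which is where the coefficient \<open>2\<close> of \<open>c\<close> is used: the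
  Cauchy-Schwarz step needs the moment bound on \<open>Z\<close> at \<open>2 l\<close>. The third bound follows since
  \<open>l \<le> 1 / k'\<close>, and the second follows from the third since \<open>l k' \<le> 1\<close>.
\<close>

lemma recursion_parameter_bounds:
  fixes a b c k k' l :: real
  assumes nonneg: "0 \<le> a" "0 < c" and k: "0 < k" "0 < k'"
    and quad: "(a * k + 2 * c) * k' + b\<^sup>2 * k \<le> k'\<^sup>2"
    and l: "0 \<le> l" "l \<le> 1 / k'"
  shows "2 * l \<le> inverse c"
    and "l * a + l\<^sup>2 * b\<^sup>2 \<le> 1 / k"
    and "l * c + (l * a + l\<^sup>2 * b\<^sup>2) * k \<le> l * k'"
proof -
  have lk: "l * k' \<le> 1"
    using l k by (simp add: field_simps)
  have quad': "a * k + b\<^sup>2 * k / k' + 2 * c \<le> k'"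
    using quad k by (simp add: field_simps power2_eq_square)
  have drift_nonneg: "0 \<le> a * k" and noise_nonneg: "0 \<le> b\<^sup>2 * k / k'"
    using nonneg k by simp_all
  have "2 * c \<le> k'"
    using quad' drift_nonneg noise_nonneg by linarith
  then have "l * (2 * c) \<le> 1"
    using mult_left_mono[of "2 * c" k' l] l lk by linarith
  then show "2 * l \<le> inverse c"
    using nonneg by (simp add: field_simps)
  have "l * (b\<^sup>2 * k) \<le> 1 / k' * (b\<^sup>2 * k)"
    using l k by (intro mult_right_mono) auto
  then have "c + a * k + l * (b\<^sup>2 * k) \<le> k'"
    using quad' nonneg by simp
  then have "l * (c + a * k + l * (b\<^sup>2 * k)) \<le> l * k'"
    using l by (intro mult_left_mono)
  then show third: "l * c + (l * a + l\<^sup>2 * b\<^sup>2) * k \<le> l * k'"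
    by (simp add: algebra_simps power2_eq_square)
  have "0 \<le> l * c"
    using l nonneg by simp
  then have "(l * a + l\<^sup>2 * b\<^sup>2) * k \<le> 1"
    using third lk by linarith
  then show "l * a + l\<^sup>2 * b\<^sup>2 \<le> 1 / k"
    using k by (simp add: field_simps)
qed

text \<open>
  The bound is proved for a whole range of \<open>l\<close>, because the parameter changes from step to step.
  The past of step \<open>i\<close> is the \<open>\<sigma>\<close>-algebra \<open>G i\<close>.
\<close>

lemma mgf_bound_along_recursion:
  fixes X Y Z :: "nat \<Rightarrow> 'a \<Rightarrow> real" and \<alpha> \<beta> \<gamma> K :: "nat \<Rightarrow> real" and x0 l :: real
  assumes "prob_space M"
    and G: "\<And>i. sigma_finite_subalgebra M (G i)"
    and X: "\<And>i. X i \<in> borel_measurable (G i)"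
    and Y: "\<And>i. Y i \<in> borel_measurable M" and Z: "\<And>i. Z i \<in> borel_measurable M"
    and X0: "AE \<omega> in M. X 0 \<omega> \<le> K 0"
    and \<alpha>_nonneg: "\<And>i. 0 \<le> \<alpha> i" and \<gamma>_pos: "\<And>i. 0 < \<gamma> i"
    and Y_mgf: "\<And>i (l::real). AE \<omega> in M.
        nn_cond_exp M (G i) (\<lambda>\<omega>. ennreal (exp (l * Y i \<omega>))) \<omega>
          \<le> ennreal (exp (l\<^sup>2 / 2 * (\<beta> i)\<^sup>2 * X i \<omega>))"
    and Z_mgf: "\<And>i (l::real). l \<in> {0..inverse (\<gamma> i)} \<Longrightarrow> AE \<omega> in M.
        nn_cond_exp M (G i) (\<lambda>\<omega>. ennreal (exp (l * Z i \<omega>))) \<omega> \<le> ennreal (exp (l * \<gamma> i))"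
    and recursion: "\<And>i. AE \<omega> in M. X (Suc i) \<omega> \<le> \<alpha> i * X i \<omega> + Y i \<omega> + Z i \<omega>"
    and K_pos: "\<And>i. 0 < K i"
    and K_Suc: "\<And>i. (\<alpha> i * K i + 2 * \<gamma> i) * K (Suc i) + (\<beta> i)\<^sup>2 * K i \<le> (K (Suc i))\<^sup>2"
    and l: "0 \<le> l" "l \<le> 1 / K n"
  shows "(\<integral>\<^sup>+ \<omega>. ennreal (exp (l * X n \<omega>)) \<partial>M) \<le> ennreal (exp (l * K n))"
  using l
proof (induction n arbitrary: l)
  case 0
  interpret prob_space M by fact
  have "(\<integral>\<^sup>+ \<omega>. ennreal (exp (l * X 0 \<omega>)) \<partial>M) \<le> (\<integral>\<^sup>+ \<omega>. ennreal (exp (l * K 0)) \<partial>M)"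
    using X0 by (intro nn_integral_mono_AE, elim AE_mp)
      (auto intro!: AE_I2 ennreal_leI mult_left_mono 0)
  then show ?case
    by (simp add: emeasure_space_1)
next
  case (Suc n)
  define m where "m = l * \<alpha> n + l\<^sup>2 * (\<beta> n)\<^sup>2"
  note bounds = recursion_parameter_bounds[OF \<alpha>_nonneg \<gamma>_pos K_pos K_pos K_Suc Suc.prems,
      folded m_def]
  have "0 \<le> m"
    using Suc.prems(1) \<alpha>_nonneg by (simp add: m_def)
  have "(\<integral>\<^sup>+ \<omega>. ennreal (exp (l * X (Suc n) \<omega>)) \<partial>M)
      \<le> (\<integral>\<^sup>+ \<omega>. ennreal (exp (l * (\<alpha> n * X n \<omega> + Y n \<omega> + Z n \<omega>))) \<partial>M)"
    using recursion[of n] by (intro nn_integral_mono_AE, elim AE_mp)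
      (auto intro!: AE_I2 ennreal_leI mult_left_mono Suc.prems(1))
  also have "\<dots> \<le> ennreal (exp (l * \<gamma> n)) * (\<integral>\<^sup>+ \<omega>. ennreal (exp (m * X n \<omega>)) \<partial>M)"
    unfolding m_def using bounds(1) Suc.prems(1)
    by (intro mgf_one_step[OF G X Y Z Y_mgf Z_mgf]) auto
  also have "\<dots> \<le> ennreal (exp (l * \<gamma> n)) * ennreal (exp (m * K n))"
    using Suc.IH[OF \<open>0 \<le> m\<close> bounds(2)] by (rule mult_left_mono) simp
  also have "\<dots> = ennreal (exp (l * \<gamma> n + m * K n))"
    by (simp add: ennreal_mult[symmetric] exp_add)
  also have "\<dots> \<le> ennreal (exp (l * K (Suc n)))"
    using bounds(3) by (intro ennreal_leI) simp
  finally show ?case .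
qed

text \<open>
  Where \<open>X\<close> exceeds the threshold, \<open>exp (X / k)\<close> exceeds \<open>exp 1 / \<delta>\<close>, that is, \<open>1 / \<delta>\<close> times the
  bound on its mean; Markov's inequality applies.
\<close>

lemma (in prob_space) tail_bound_of_exp_moment:
  fixes X :: "'a \<Rightarrow> real" and k \<delta> :: real
  assumes X [measurable]: "X \<in> borel_measurable M" and "0 < k" "0 < \<delta>"
    and moment: "(\<integral>\<^sup>+ \<omega>. ennreal (exp (X \<omega> / k)) \<partial>M) \<le> ennreal (exp 1)"
  shows "1 - \<delta> \<le> prob {\<omega> \<in> space M. X \<omega> \<le> k * ln (exp 1 / \<delta>)}"
proof -
  let ?A = "{\<omega> \<in> space M. X \<omega> \<le> k * ln (exp 1 / \<delta>)}"
  have A [measurable]: "?A \<in> events"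
    by measurable
  have exceed: "1 \<le> ennreal (\<delta> / exp 1) * ennreal (exp (X \<omega> / k))" if "\<omega> \<in> space M - ?A" for \<omega>
  proof -
    have "k * ln (exp 1 / \<delta>) < X \<omega>"
      using that by auto
    then have "ln (exp 1 / \<delta>) < X \<omega> / k"
      using \<open>0 < k\<close> by (simp add: field_simps)
    then have "exp (ln (exp 1 / \<delta>)) < exp (X \<omega> / k)"
      by simp
    then have "exp 1 / \<delta> < exp (X \<omega> / k)"
      using \<open>0 < \<delta>\<close> by simp
    then have "1 \<le> \<delta> / exp 1 * exp (X \<omega> / k)"
      using \<open>0 < \<delta>\<close> by (simp add: field_simps)
    then show ?thesis
      using \<open>0 < \<delta>\<close> by (simp add: ennreal_mult[symmetric] del: ennreal_1 flip: ennreal_1)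
  qed
  have "emeasure M (space M - ?A) = emeasure M ({\<omega> \<in> space M.
      1 \<le> ennreal (\<delta> / exp 1) * ennreal (exp (X \<omega> / k))} \<inter> (space M - ?A))"
    using exceed by (intro arg_cong[where f = "emeasure M"]) auto
  also have "\<dots> \<le> emeasure M {\<omega> \<in> space M. 1 \<le> ennreal (\<delta> / exp 1) * ennreal (exp (X \<omega> / k))}"
    by (intro emeasure_mono) auto
  also have "\<dots> \<le> ennreal (\<delta> / exp 1) * (\<integral>\<^sup>+ \<omega>. ennreal (exp (X \<omega> / k)) \<partial>M)"
    using nn_integral_Markov_inequality[of "\<lambda>\<omega>. ennreal (exp (X \<omega> / k))" "space M" M
        "ennreal (\<delta> / exp 1)"] by (simp add: indicator_def cong: nn_integral_cong)
  also have "\<dots> \<le> ennreal (\<delta> / exp 1) * ennreal (exp 1)"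
    using moment by (rule mult_left_mono) simp
  also have "\<dots> = ennreal \<delta>"
    using \<open>0 < \<delta>\<close> by (simp add: ennreal_mult[symmetric])
  finally have "prob (space M - ?A) \<le> \<delta>"
    using \<open>0 < \<delta>\<close> by (simp add: emeasure_eq_measure)
  then show ?thesis
    using prob_compl[OF A] by simp
qed

theorem theorem9:
  fixes M :: "'a measure"
    and F :: "int \<Rightarrow> 'a measure"
    and X Y Z :: "nat \<Rightarrow> 'a \<Rightarrow> real"
    and \<alpha> \<beta> \<gamma> K :: "nat \<Rightarrow> real"
    and x0 \<delta> :: real
    and n :: nat
  assumes filt: "filtered_prob_space M F"
    and X_adapted: "\<And>i. X (Suc i) \<in> borel_measurable (F (int i))"
    and Y_adapted: "\<And>i. Y i \<in> borel_measurable (F (int i))"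
    and Z_adapted: "\<And>i. Z i \<in> borel_measurable (F (int i))"
    and X0_deterministic: "\<And>\<omega>. \<omega> \<in> space M \<Longrightarrow> X 0 \<omega> = x0"
    and \<alpha>_nonneg: "\<And>i. 0 \<le> \<alpha> i"
    and \<beta>_nonneg: "\<And>i. 0 \<le> \<beta> i"
    and \<gamma>_pos: "\<And>i. 0 < \<gamma> i"
    and X_nonneg: "\<And>i. AE \<omega> in M. 0 \<le> X i \<omega>"
    and Z_nonneg: "\<And>i. AE \<omega> in M. 0 \<le> Z i \<omega>"
    and Y_mgf: "\<And>i (l::real). AE \<omega> in M.
        nn_cond_exp M (F (int i - 1)) (\<lambda>\<omega>. ennreal (exp (l * Y i \<omega>))) \<omega>
          \<le> ennreal (exp (l\<^sup>2 / 2 * (\<beta> i)\<^sup>2 * X i \<omega>))"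
    and Z_mgf: "\<And>i (l::real). l \<in> {0..inverse (\<gamma> i)} \<Longrightarrow> AE \<omega> in M.
        nn_cond_exp M (F (int i - 1)) (\<lambda>\<omega>. ennreal (exp (l * Z i \<omega>))) \<omega>
          \<le> ennreal (exp (l * \<gamma> i))"
    and recursion: "\<And>i. AE \<omega> in M. X (Suc i) \<omega> \<le> \<alpha> i * X i \<omega> + Y i \<omega> + Z i \<omega>"
    and K_pos: "\<And>i. 0 < K i"
    and K_0: "x0 \<le> K 0"
    and K_Suc: "\<And>i. (\<alpha> i * K i + 2 * \<gamma> i) * K (Suc i) + (\<beta> i)\<^sup>2 * K i \<le> (K (Suc i))\<^sup>2"
    and \<delta>: "\<delta> \<in> {0<..<1}"
  shows "1 - \<delta> \<le> measure M {\<omega> \<in> space M. X n \<omega> \<le> K n * ln (exp 1 / \<delta>)}"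
proof -
  interpret prob_space M
    using filt by (simp add: filtered_prob_space_def)
  \<comment> \<open>The index shift reflects that \<open>X i\<close> is already known at the time before the noise \<open>Y i\<close>,
      \<open>Z i\<close> is.\<close>
  define G where "G i = F (int i - 1)" for i
  have subalg: "subalgebra M (F i)" if "-1 \<le> i" for i
    using filt that by (simp add: filtered_prob_space_def)
  have G: "sigma_finite_subalgebra M (G i)" for i
    using subalg[of "int i - 1"] unfolding G_def
    by (intro finite_measure_subalgebra_is_sigma_finite finite_measure_subalgebra.intro
        finite_measure_axioms finite_measure_subalgebra_axioms.intro) simp
  have X: "X i \<in> borel_measurable (G i)" for i
  proof (cases i)
    case 0
    have "space (G 0) = space M"
      using subalg[of "-1"] by (simp add: G_def subalgebra_def)
    then have "X 0 \<in> borel_measurable (G 0) \<longleftrightarrow> (\<lambda>_. x0) \<in> borel_measurable (G 0)"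
      using X0_deterministic by (intro measurable_cong) simp
    then show ?thesis
      using 0 by simp
  next
    case (Suc j)
    then show ?thesis
      using X_adapted[of j] by (simp add: G_def)
  qed
  have Y: "Y i \<in> borel_measurable M" and Z: "Z i \<in> borel_measurable M" for i
    using measurable_from_subalg[OF subalg[of "int i"]] Y_adapted Z_adapted by auto
  have X0: "AE \<omega> in M. X 0 \<omega> \<le> K 0"
    using X0_deterministic K_0 by (intro AE_I2) simp
  have "(\<integral>\<^sup>+ \<omega>. ennreal (exp (1 / K n * X n \<omega>)) \<partial>M) \<le> ennreal (exp (1 / K n * K n))"
    using Y_mgf Z_mgf K_pos[of n] unfolding G_def[symmetric]
    by (intro mgf_bound_along_recursion[OF prob_space_axioms G X Y Z X0 \<alpha>_nonneg \<gamma>_pos _ _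
          recursion K_pos K_Suc]) simp_all
  moreover have "X n \<in> borel_measurable M"
    using X sigma_finite_subalgebra.subalg[OF G] measurable_from_subalg by blast
  ultimately show ?thesis
    using tail_bound_of_exp_moment[of "X n" "K n" \<delta>] K_pos[of n] \<delta> by simp
qed

end
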